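(* Let $\pi\in\Pi$, $\delta\in(0,1]$ and $\lambda>0$. Then the following inequalities hold with probability at least $1-\delta$: $$R(\pi)-\hat{R}^\lambda_n(\pi)\le\frac{\ln(2/\delta)}{\lambda n}\qquad\text{and}\qquad \hat{R}^\lambda_n(\pi)-R(\pi)\le\lambda\,\mathcal{S}_\lambda(\pi)+\frac{\ln(2/\delta)}{\lambda n}.$$ In particular, if $0<\mathbb{E}[w_\pi(x,a)^2c^2]<\infty$, setting $\lambda=\lambda_*=\sqrt{\ln(2/\delta)/\big(n\,\mathbb{E}[w_\pi(x,a)^2c^2]\big)}$ yields, with probability at least $1-\delta$, $$|R(\pi)-\hat{R}^{\lambda_*}_n(\pi)|\le\sqrt{2\sigma^2\ln(2/\delta)},\qquad\text{where }\sigma^2=\frac{2\,\mathbb{E}[w_\pi(x,a)^2c^2]}{n}.$$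
   Context: Setting (offline contextual bandit). $\mathcal{X}\subset\mathbb{R}^d$ is a compact context space, $\mathcal{A}=\{1,\dots,K\}$ a finite action set, $\nu$ a probability distribution on $\mathcal{X}$. A policy $\pi$ assigns to each $x\in\mathcal{X}$ a probability distribution $\pi(\cdot|x)$ on $\mathcal{A}$; $\Pi$ is the set of policies and $\pi_0$ is a fixed behavior policy. Given $(x,a)$, a cost $c\in[-1,0]$ is drawn from a distribution $p(\cdot|x,a)$, with mean $c(x,a)$. The logged data $\mathcal{D}_n=(x_i,a_i,c_i)_{i\in[n]}$ consists of $n$ i.i.d. tuples with $x_i\sim\nu$, $a_i\sim\pi_0(\cdot|x_i)$, $c_i\sim p(\cdot|x_i,a_i)$; probabilities are over $\mathcal{D}_n$. The risk of a policy is $R(\pi)=\mathbb{E}_{x\sim\nu,\,a\sim\pi(\cdot|x)}[c(x,a)]$. Expectations $\mathbb{E}$ without subscript are with respect to $x\sim\nu$, $a\sim\pi_0(\cdot|x)$, $c\sim p(\cdot|x,a)$. Coverage assumption: for $\nu$-almost every $x$ and every $a$, $\pi(a|x)>0$ implies $\pi_0(a|x)>0$. Notation. $w_\pi(x,a)=\pi(a|x)/\pi_0(a|x)$. The Logarithmic Smoothing estimator is $$\hat{R}^\lambda_n(\pi)=-\frac1n\sum_{i=1}^n\frac1\lambda\log\big(1-\lambda w_\pi(x_i,a_i)c_i\big),$$ and $$\mathcal{S}_\lambda(\pi)=\mathbb{E}\left[\frac{(w_\pi(x,a)c)^2}{1-\lambda w_\pi(x,a)c}\right].$$ *)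

theory Defs
  imports "HOL-Probability.Probability"
begin

abbreviation context_space :: "(real ^ 'd::finite) set \<Rightarrow> (real ^ 'd) measure" where
  "context_space X \<equiv> restrict_space borel X"

abbreviation action_space :: "nat \<Rightarrow> nat measure" where
  "action_space K \<equiv> count_space {1..K}"

abbreviation cost_space :: "real measure" where
  "cost_space \<equiv> restrict_space borel {-1..0}"

text \<open>
  A policy is a Markov kernel from contexts to actions: \<open>\<pi> x\<close> is the distribution
  written $\pi(\cdot|x)$, and \<open>measure (\<pi> x) {a}\<close> is $\pi(a|x)$.
\<close>

definition policies :: "(real ^ 'd::finite) set \<Rightarrow> nat \<Rightarrow> (real ^ 'd \<Rightarrow> nat measure) set" where
  "policies X K = measurable (context_space X) (prob_algebra (action_space K))"

definition cost_kernels ::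
  "(real ^ 'd::finite) set \<Rightarrow> nat \<Rightarrow> (real ^ 'd \<Rightarrow> nat \<Rightarrow> real measure) set" where
  "cost_kernels X K =
     {p. (\<lambda>(x, a). p x a) \<in>
        measurable (context_space X \<Otimes>\<^sub>M action_space K) (prob_algebra cost_space)}"

definition mean_cost :: "('x \<Rightarrow> 'a \<Rightarrow> real measure) \<Rightarrow> 'x \<Rightarrow> 'a \<Rightarrow> real" where
  "mean_cost p x a = (\<integral>c. c \<partial>p x a)"

definition risk ::
  "'x measure \<Rightarrow> ('x \<Rightarrow> 'a \<Rightarrow> real measure) \<Rightarrow> ('x \<Rightarrow> 'a measure) \<Rightarrow> real" where
  "risk \<nu> p \<pi> = (\<integral>x. (\<integral>a. mean_cost p x a \<partial>\<pi> x) \<partial>\<nu>)"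

definition covers :: "'x measure \<Rightarrow> 'a set \<Rightarrow> ('x \<Rightarrow> 'a measure) \<Rightarrow> ('x \<Rightarrow> 'a measure) \<Rightarrow> bool" where
  "covers \<nu> A \<pi>0 \<pi> \<longleftrightarrow>
     (AE x in \<nu>. \<forall>a\<in>A. measure (\<pi> x) {a} > 0 \<longrightarrow> measure (\<pi>0 x) {a} > 0)"

text \<open>The law of one logged tuple \<open>(x, a, c)\<close>, on contexts \<open>\<times>\<close> actions \<open>\<times>\<close> costs.\<close>

definition logging_law ::
  "(real ^ 'd::finite) set \<Rightarrow> nat \<Rightarrow> (real ^ 'd) measure \<Rightarrow> (real ^ 'd \<Rightarrow> nat measure) \<Rightarrow>
   (real ^ 'd \<Rightarrow> nat \<Rightarrow> real measure) \<Rightarrow> ((real ^ 'd) \<times> nat \<times> real) measure" where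
  "logging_law X K \<nu> \<pi>0 p =
     do {
       x \<leftarrow> \<nu>;
       a \<leftarrow> \<pi>0 x;
       c \<leftarrow> p x a;
       return (context_space X \<Otimes>\<^sub>M action_space K \<Otimes>\<^sub>M cost_space) (x, a, c)
     }"

definition iid_sample :: "'w measure \<Rightarrow> nat \<Rightarrow> 'z measure \<Rightarrow> (nat \<Rightarrow> 'w \<Rightarrow> 'z) \<Rightarrow> bool" where
  "iid_sample M n L Z \<longleftrightarrow>
     prob_space.indep_vars M (\<lambda>_. L) Z {1..n} \<and> (\<forall>i\<in>{1..n}. distr M L (Z i) = L)"

text \<open>
  Where \<open>\<pi>0\<close> gives an action probability 0 the quotient is 0 by convention; such pairs
  have probability 0 under the logging law.
\<close>

definition importance_weight ::
  "('x \<Rightarrow> 'a measure) \<Rightarrow> ('x \<Rightarrow> 'a measure) \<Rightarrow> 'x \<Rightarrow> 'a \<Rightarrow> real" where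
  "importance_weight \<pi>0 \<pi> x a = measure (\<pi> x) {a} / measure (\<pi>0 x) {a}"

definition ls_estimator ::
  "('x \<Rightarrow> 'a measure) \<Rightarrow> nat \<Rightarrow> (nat \<Rightarrow> 'x \<times> 'a \<times> real) \<Rightarrow> real \<Rightarrow> ('x \<Rightarrow> 'a measure) \<Rightarrow> real" where
  "ls_estimator \<pi>0 n z lam \<pi> =
     - (1 / real n) * (\<Sum>i = 1..n. case z i of (x, a, c) \<Rightarrow>
         (1 / lam) * ln (1 - lam * importance_weight \<pi>0 \<pi> x a * c))"

text \<open>
  In the next definition \<open>L\<close> is the logging law. For \<open>lam > 0\<close> the integrand is at most
  \<open>\<bar>w * c\<bar> / lam \<le> w / lam\<close>, and the importance weight \<open>w\<close> has mean at most 1, so the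
  integral is always a genuine one.
\<close>

definition ls_discrepancy ::
  "('x \<times> 'a \<times> real) measure \<Rightarrow> ('x \<Rightarrow> 'a measure) \<Rightarrow> real \<Rightarrow> ('x \<Rightarrow> 'a measure) \<Rightarrow> real" where
  "ls_discrepancy L \<pi>0 lam \<pi> =
     (\<integral>(x, a, c). (importance_weight \<pi>0 \<pi> x a * c)\<^sup>2
                    / (1 - lam * importance_weight \<pi>0 \<pi> x a * c) \<partial>L)"

definition weighted_cost_sq ::
  "('x \<Rightarrow> 'a measure) \<Rightarrow> ('x \<Rightarrow> 'a measure) \<Rightarrow> 'x \<times> 'a \<times> real \<Rightarrow> real" where
  "weighted_cost_sq \<pi>0 \<pi> = (\<lambda>(x, a, c). (importance_weight \<pi>0 \<pi> x a)\<^sup>2 * c\<^sup>2)"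

end

theory Submission
  imports Defs
begin

text \<open>
  Put $V = -w_\pi(x,a)\,c \ge 0$. Changing the measure from $\pi_0$ to $\pi$, which the coverage
  assumption allows, gives $\mathbb{E}[V] = -R(\pi)$. Both inequalities are Chernoff bounds for
  $\pm\sum_i \ln(1 + \lambda V_i)$, based on
  $\mathbb{E}[1 + \lambda V] \le \exp(\lambda\,\mathbb{E}[V])$ and
  $\mathbb{E}[1/(1 + \lambda V)] = 1 - \lambda\,\mathbb{E}[V/(1 + \lambda V)]
    \le \exp(-\lambda\,\mathbb{E}[V] + \lambda^2 \mathcal{S}_\lambda(\pi))$.
  At $\lambda_*$ the bound $\mathcal{S}_\lambda(\pi) \le \mathbb{E}[V^2]$ makes the two summands
  of the second inequality equal.
\<close>

section \<open>Finite action sets and exponential bounds for i.i.d. samples\<close>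

text \<open>Lets \<open>\<pi>0 x\<close> and \<open>\<pi> x\<close> be compared action by action.
  Only the sigma-algebra of \<open>N\<close> is fixed to be discrete, because a policy takes
  arbitrary distributions as values.\<close>

lemma nn_integral_sets_count_space_finite:
  assumes "finite A" and N: "sets N = sets (count_space A)"
  shows "(\<integral>\<^sup>+a. f a \<partial>N) = (\<Sum>a\<in>A. f a * emeasure N {a})"
proof -
  have sp: "space N = A"
    using sets_eq_imp_space_eq[OF N] by simp
  have "(\<integral>\<^sup>+a. f a \<partial>N) = (\<integral>\<^sup>+a. (\<Sum>b\<in>A. f b * indicator {b} a) \<partial>N)"
    using assms(1) by (intro nn_integral_cong) (simp add: sp indicator_def if_distrib cong: if_cong)
  also have "\<dots> = (\<Sum>b\<in>A. \<integral>\<^sup>+a. f b * indicator {b} a \<partial>N)"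
    by (rule nn_integral_sum)
      (auto simp: N intro!: borel_measurable_times_ennreal borel_measurable_indicator)
  also have "\<dots> = (\<Sum>b\<in>A. f b * emeasure N {b})"
    by (intro sum.cong refl nn_integral_cmult_indicator) (auto simp: N)
  finally show ?thesis .
qed

text \<open>Markov's inequality applied to the exponential of the sum, whose expectation factorizes
  by independence. With values in \<open>ennreal\<close> the factorization and the moment bound
  \<open>le\<close> carry no integrability side conditions.\<close>

lemma iid_sample_chernoff:
  assumes "prob_space M" and iid: "iid_sample M n L Z"
    and f[measurable]: "f \<in> borel_measurable L"
    and le: "(\<integral>\<^sup>+z. ennreal (exp (f z)) \<partial>L) \<le> ennreal (exp b)"
    and \<epsilon>: "0 < \<epsilon>"
  shows "measure M {\<omega> \<in> space M. real n * b + ln (1 / \<epsilon>) < (\<Sum>i = 1..n. f (Z i \<omega>))} \<le> \<epsilon>"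
proof -
  interpret prob_space M by fact
  have ind: "indep_vars (\<lambda>_. L) Z {1..n}" and d: "\<And>i. i \<in> {1..n} \<Longrightarrow> distr M L (Z i) = L"
    using iid by (auto simp: iid_sample_def)
  have Z[measurable]: "Z i \<in> measurable M L" if "i \<in> {1..n}" for i
    using ind that by (auto simp: indep_vars_def)
  let ?u = "\<lambda>\<omega>. \<Prod>i\<in>{1..n}. ennreal (exp (f (Z i \<omega>)))"
  \<comment> \<open>The inverse of \<open>exp (real n * b + ln (1 / \<epsilon>))\<close>: on the
    deviation event \<open>?c * ?u \<omega>\<close> is at least 1, and \<open>?c\<close> times the
    moment bound \<open>exp (real n * b)\<close> is exactly \<open>\<epsilon>\<close>.\<close>
  let ?c = "ennreal (\<epsilon> * exp (- (real n * b)))"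
  have um: "?u \<in> borel_measurable M"
    by (intro borel_measurable_prod_ennreal) measurable
  have u: "?u \<omega> = ennreal (exp (\<Sum>i = 1..n. f (Z i \<omega>)))" for \<omega>
    by (simp add: exp_sum prod_ennreal)
  have "(\<integral>\<^sup>+\<omega>. ?u \<omega> \<partial>M) = (\<Prod>i\<in>{1..n}. \<integral>\<^sup>+\<omega>. ennreal (exp (f (Z i \<omega>))) \<partial>M)"
  proof (rule indep_vars_nn_integral)
    show "indep_vars (\<lambda>_. borel) (\<lambda>i \<omega>. ennreal (exp (f (Z i \<omega>)))) {1..n}"
      by (rule indep_vars_compose2[OF ind, where Y = "\<lambda>_ z. ennreal (exp (f z))"]) measurable
  qed auto
  also have "\<dots> = (\<Prod>i\<in>{1..n}. \<integral>\<^sup>+z. ennreal (exp (f z)) \<partial>L)"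
  proof (rule prod.cong[OF refl])
    fix i assume i: "i \<in> {1..n}"
    have "(\<integral>\<^sup>+z. ennreal (exp (f z)) \<partial>L) = (\<integral>\<^sup>+z. ennreal (exp (f z)) \<partial>distr M L (Z i))"
      using d[OF i] by simp
    also have "\<dots> = (\<integral>\<^sup>+\<omega>. ennreal (exp (f (Z i \<omega>))) \<partial>M)"
      using i by (intro nn_integral_distr) auto
    finally show "(\<integral>\<^sup>+\<omega>. ennreal (exp (f (Z i \<omega>))) \<partial>M) = (\<integral>\<^sup>+z. ennreal (exp (f z)) \<partial>L)" ..
  qed
  also have "\<dots> \<le> (\<Prod>i\<in>{1..n}. ennreal (exp b))"
    by (intro prod_mono_ennreal le)
  also have "\<dots> = ennreal (exp (real n * b))"
    by (simp add: ennreal_power exp_of_nat_mult)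
  finally have int: "(\<integral>\<^sup>+\<omega>. ?u \<omega> \<partial>M) \<le> ennreal (exp (real n * b))" .
  let ?E = "{\<omega> \<in> space M. real n * b + ln (1 / \<epsilon>) < (\<Sum>i = 1..n. f (Z i \<omega>))}"
  have "emeasure M ?E \<le> emeasure M {\<omega> \<in> space M. 1 \<le> ?c * ?u \<omega>}"
  proof (rule emeasure_mono)
    show "?E \<subseteq> {\<omega> \<in> space M. 1 \<le> ?c * ?u \<omega>}"
    proof safe
      fix \<omega> assume *: "real n * b + ln (1 / \<epsilon>) < (\<Sum>i = 1..n. f (Z i \<omega>))"
      have "1 = \<epsilon> * exp (- (real n * b)) * exp (real n * b + ln (1 / \<epsilon>))"
        using \<epsilon> by (simp add: exp_add exp_minus)
      also have "\<dots> \<le> \<epsilon> * exp (- (real n * b)) * exp (\<Sum>i = 1..n. f (Z i \<omega>))"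
        using * \<epsilon> by (intro mult_left_mono) auto
      finally have "ennreal 1 \<le> ennreal (\<epsilon> * exp (- (real n * b)) * exp (\<Sum>i = 1..n. f (Z i \<omega>)))"
        by (rule ennreal_leI)
      then show "1 \<le> ?c * ?u \<omega>"
        using \<epsilon> unfolding u by (simp add: ennreal_mult)
    qed
    show "{\<omega> \<in> space M. 1 \<le> ?c * ?u \<omega>} \<in> sets M"
      using um by measurable
  qed
  also have "\<dots> \<le> ?c * (\<integral>\<^sup>+\<omega>. ?u \<omega> * indicator (space M) \<omega> \<partial>M)"
    using um by (intro nn_integral_Markov_inequality) auto
  also have "(\<integral>\<^sup>+\<omega>. ?u \<omega> * indicator (space M) \<omega> \<partial>M) = (\<integral>\<^sup>+\<omega>. ?u \<omega> \<partial>M)"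
    by (intro nn_integral_cong) simp
  also have "?c * \<dots> \<le> ?c * ennreal (exp (real n * b))"
    using int by (rule mult_left_mono) simp
  also have "\<dots> = ennreal \<epsilon>"
    using \<epsilon> by (simp add: ennreal_mult[symmetric] exp_minus)
  finally show ?thesis
    using \<epsilon> by (simp add: emeasure_eq_measure)
qed

text \<open>The concentration argument for an abstract nonnegative integrable \<open>V\<close>, free
  of policies and kernels. One Chernoff bound for each sign of the logarithm, at level \<delta>/2,
  and a union bound give the event.\<close>

lemma iid_sample_log_smoothing:
  assumes "prob_space M" and iid: "iid_sample M n L Z" and n: "n \<ge> 1"
    and "prob_space L" and int: "integrable L V" and nn: "\<And>z. z \<in> space L \<Longrightarrow> 0 \<le> V z"
    and lam: "0 < lam" and \<delta>: "0 < \<delta>"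
  defines "m \<equiv> \<integral>z. V z \<partial>L"
    and "A \<equiv> \<lambda>\<omega>. (\<Sum>i = 1..n. ln (1 + lam * V (Z i \<omega>))) / (lam * real n)"
    and "S \<equiv> \<integral>z. (V z)\<^sup>2 / (1 + lam * V z) \<partial>L"
  shows "A \<in> borel_measurable M"
    and "1 - \<delta> \<le> measure M {\<omega> \<in> space M. A \<omega> - m \<le> ln (2 / \<delta>) / (lam * real n) \<and>
            m - A \<omega> \<le> lam * S + ln (2 / \<delta>) / (lam * real n)}"
      (is "_ \<le> measure M ?G")
proof -
  interpret prob_space M by fact
  interpret L: prob_space L by fact
  have V[measurable]: "V \<in> borel_measurable L" using int by simp
  have ind: "indep_vars (\<lambda>_. L) Z {1..n}"
    using iid by (auto simp: iid_sample_def)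
  have Z[measurable]: "Z i \<in> measurable M L" if "i \<in> {1..n}" for i
    using ind that by (auto simp: indep_vars_def)
  have pos: "0 < 1 + lam * V z" if "z \<in> space L" for z
    using nn[OF that] lam by (simp add: add_pos_nonneg)
  show A[measurable]: "A \<in> borel_measurable M"
    unfolding A_def by (intro borel_measurable_divide borel_measurable_sum) measurable
  have G: "?G \<in> sets M" by measurable
  \<comment> \<open>Domination by a multiple of \<open>V\<close>: lam V^2 \<le> V (1 + lam V). Hence
    \<open>S\<close> is a genuine integral even when \<open>V\<close> has no second moment.\<close>
  have intS: "integrable L (\<lambda>z. (V z)\<^sup>2 / (1 + lam * V z))"
  proof (rule Bochner_Integration.integrable_bound[of L "\<lambda>z. V z / lam"])
    show "integrable L (\<lambda>z. V z / lam)" using int by simp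
    show "AE z in L. norm ((V z)\<^sup>2 / (1 + lam * V z)) \<le> norm (V z / lam)"
    proof (rule AE_I2)
      fix z assume z: "z \<in> space L"
      show "norm ((V z)\<^sup>2 / (1 + lam * V z)) \<le> norm (V z / lam)"
        using nn[OF z] lam pos[OF z] by (simp add: field_simps power2_eq_square)
    qed
  qed measurable
  have up: "(\<integral>\<^sup>+z. ennreal (exp (ln (1 + lam * V z))) \<partial>L) \<le> ennreal (exp (lam * m))"
  proof -
    have "(\<integral>\<^sup>+z. ennreal (exp (ln (1 + lam * V z))) \<partial>L) = (\<integral>\<^sup>+z. ennreal (1 + lam * V z) \<partial>L)"
      by (intro nn_integral_cong) (simp add: pos)
    also have "\<dots> = ennreal (\<integral>z. 1 + lam * V z \<partial>L)"
      using int pos by (intro nn_integral_eq_integral) (auto simp: less_imp_le)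
    also have "(\<integral>z. 1 + lam * V z \<partial>L) = 1 + lam * m"
      using int by (simp add: m_def L.prob_space)
    also have "ennreal (1 + lam * m) \<le> ennreal (exp (lam * m))"
      by (intro ennreal_leI exp_ge_add_one_self)
    finally show ?thesis .
  qed
  have lo: "(\<integral>\<^sup>+z. ennreal (exp (- ln (1 + lam * V z))) \<partial>L) \<le> ennreal (exp (- (lam * m) + lam\<^sup>2 * S))"
  proof -
    define Q where "Q z = (V z)\<^sup>2 / (1 + lam * V z)" for z
    have intQ: "integrable L Q" and Q: "(\<integral>z. Q z \<partial>L) = S"
      using intS by (simp_all add: Q_def[abs_def] S_def)
    \<comment> \<open>The exact expansion 1/(1+u) = 1 - u + u^2/(1+u) at u = lam V; its remainder is
      what makes \<open>S\<close> appear in the bound.\<close>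
    have inverse: "exp (- ln (1 + lam * V z)) = 1 - lam * V z + lam\<^sup>2 * Q z" if "z \<in> space L" for z
      using pos[OF that] by (simp add: Q_def exp_minus field_simps power2_eq_square)
    have "(\<integral>\<^sup>+z. ennreal (exp (- ln (1 + lam * V z))) \<partial>L)
        = (\<integral>\<^sup>+z. ennreal (1 - lam * V z + lam\<^sup>2 * Q z) \<partial>L)"
      by (intro nn_integral_cong) (simp add: inverse)
    \<comment> \<open>Nonnegativity of the integrand is hidden in its expanded form; rewriting it
      back to an exponential by \<open>inverse\<close> makes it evident.\<close>
    also have "\<dots> = ennreal (\<integral>z. 1 - lam * V z + lam\<^sup>2 * Q z \<partial>L)"
      using int intQ by (intro nn_integral_eq_integral) (auto simp flip: inverse)
    also have "(\<integral>z. 1 - lam * V z + lam\<^sup>2 * Q z \<partial>L) = 1 - lam * m + lam\<^sup>2 * S"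
      using int intQ by (simp add: m_def Q L.prob_space)
    also have "ennreal (1 - lam * m + lam\<^sup>2 * S) \<le> ennreal (exp (- (lam * m) + lam\<^sup>2 * S))"
      using exp_ge_add_one_self[of "- (lam * m) + lam\<^sup>2 * S"] by (intro ennreal_leI) linarith
    finally show ?thesis .
  qed
  let ?s = "\<lambda>\<omega>. \<Sum>i = 1..n. ln (1 + lam * V (Z i \<omega>))"
  \<comment> \<open>Both failure events have the form required by \<open>iid_sample_chernoff\<close>
    with \<open>\<epsilon>\<close> equal to \<delta>/2. Since ln(1/(\<delta>/2)) = ln(2/\<delta>),
    dividing the thresholds by lam n leads to the stated bounds.\<close>
  let ?B = "{\<omega> \<in> space M. real n * (lam * m) + ln (1 / (\<delta> / 2)) < ?s \<omega>}"
  let ?C = "{\<omega> \<in> space M. real n * (- (lam * m) + lam\<^sup>2 * S) + ln (1 / (\<delta> / 2))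
              < (\<Sum>i = 1..n. - ln (1 + lam * V (Z i \<omega>)))}"
  have "measure M ?B \<le> \<delta> / 2"
    by (rule iid_sample_chernoff[OF \<open>prob_space M\<close> iid _ up]) (use \<delta> in auto)
  moreover have "measure M ?C \<le> \<delta> / 2"
    by (rule iid_sample_chernoff[OF \<open>prob_space M\<close> iid _ lo]) (use \<delta> in auto)
  moreover have BC: "?B \<in> sets M" "?C \<in> sets M"
  proof -
    have s: "?s \<in> borel_measurable M"
      by (intro borel_measurable_sum) measurable
    then show "?B \<in> sets M" by measurable
    show "?C \<in> sets M" using s unfolding sum_negf by measurable
  qed
  moreover have "space M - ?G \<subseteq> ?B \<union> ?C"
  proof (rule subsetI, rule ccontr)
    fix \<omega> assume \<omega>: "\<omega> \<in> space M - ?G" and no: "\<omega> \<notin> ?B \<union> ?C"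
    have pn: "0 < lam * real n" using lam n by simp
    have 1: "?s \<omega> \<le> lam * real n * m + ln (2 / \<delta>)"
      using no \<omega> by (simp add: not_less algebra_simps)
    have 2: "lam * real n * m \<le> ?s \<omega> + lam * real n * (lam * S) + ln (2 / \<delta>)"
      using no \<omega> by (simp add: not_less sum_negf algebra_simps power2_eq_square)
    have "A \<omega> - m \<le> ln (2 / \<delta>) / (lam * real n)"
      using 1 pn unfolding A_def by (simp add: field_simps)
    moreover have "m - A \<omega> \<le> lam * S + ln (2 / \<delta>) / (lam * real n)"
    proof -
      have "m \<le> (?s \<omega> + lam * real n * (lam * S) + ln (2 / \<delta>)) / (lam * real n)"
        using 2 pn by (simp add: pos_le_divide_eq mult_ac)
      also have "\<dots> = A \<omega> + lam * S + ln (2 / \<delta>) / (lam * real n)"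
        using pn unfolding A_def add_divide_distrib by (metis nonzero_mult_div_cancel_left less_irrefl)
      finally show ?thesis by linarith
    qed
    ultimately show False using \<omega> by simp
  qed
  ultimately have "measure M (space M - ?G) \<le> \<delta>"
    using finite_measure_mono[of "space M - ?G" "?B \<union> ?C"] measure_Un_le[OF BC]
    by (auto intro: order.trans)
  then show "1 - \<delta> \<le> measure M ?G"
    using prob_compl[OF G] by simp
qed

section \<open>The bandit model and integration against its logging law\<close>

context
  fixes X :: "(real ^ 'd::finite) set" and K :: nat
    and \<nu> :: "(real ^ 'd) measure"
    and \<pi>0 \<pi> :: "real ^ 'd \<Rightarrow> nat measure"
    and p :: "real ^ 'd \<Rightarrow> nat \<Rightarrow> real measure"
  assumes \<nu>: "\<nu> \<in> space (prob_algebra (context_space X))"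
    and \<pi>0: "\<pi>0 \<in> policies X K"
    and \<pi>: "\<pi> \<in> policies X K"
    and p: "p \<in> cost_kernels X K"
begin

abbreviation "log_space \<equiv> context_space X \<Otimes>\<^sub>M action_space K \<Otimes>\<^sub>M cost_space"

lemma policy_measurable[measurable]:
  "\<pi>0 \<in> context_space X \<rightarrow>\<^sub>M prob_algebra (action_space K)"
  "\<pi> \<in> context_space X \<rightarrow>\<^sub>M prob_algebra (action_space K)"
  using \<pi>0 \<pi> by (auto simp: policies_def)

lemma cost_kernel_measurable[measurable]:
  "(\<lambda>(x, a). p x a) \<in> context_space X \<Otimes>\<^sub>M action_space K \<rightarrow>\<^sub>M prob_algebra cost_space"
  using p by (simp add: cost_kernels_def)

lemma sets_\<nu>[measurable_cong]: "sets \<nu> = sets (context_space X)"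
  and prob_space_\<nu>: "prob_space \<nu>"
  using \<nu> by (auto simp: space_prob_algebra)

lemma space_\<nu>: "space \<nu> = X"
  using sets_eq_imp_space_eq[OF sets_\<nu>] by (simp add: space_restrict_space)

lemma policy_prob:
  assumes "x \<in> X"
  shows "prob_space (\<pi>0 x)" "sets (\<pi>0 x) = sets (action_space K)" "space (\<pi>0 x) = {1..K}"
    and "prob_space (\<pi> x)" "sets (\<pi> x) = sets (action_space K)" "space (\<pi> x) = {1..K}"
proof -
  have x: "x \<in> space (context_space X)" using assms by (simp add: space_restrict_space)
  note P = measurable_space[OF policy_measurable(1) x] measurable_space[OF policy_measurable(2) x]
  then show "prob_space (\<pi>0 x)" "sets (\<pi>0 x) = sets (action_space K)"
    "prob_space (\<pi> x)" "sets (\<pi> x) = sets (action_space K)"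
    unfolding space_prob_algebra by auto
  then show "space (\<pi>0 x) = {1..K}" "space (\<pi> x) = {1..K}"
    by (metis sets_eq_imp_space_eq space_count_space)+
qed

lemma cost_kernel_prob:
  assumes "x \<in> X" "a \<in> {1..K}"
  shows "prob_space (p x a)" "sets (p x a) = sets cost_space" "space (p x a) = {-1..0}"
proof -
  have "(x, a) \<in> space (context_space X \<Otimes>\<^sub>M action_space K)"
    using assms by (simp add: space_pair_measure space_restrict_space)
  from measurable_space[OF cost_kernel_measurable this]
  show "prob_space (p x a)" and *: "sets (p x a) = sets cost_space"
    unfolding space_prob_algebra by auto
  show "space (p x a) = {-1..0}"
    using sets_eq_imp_space_eq[OF *] by (simp add: space_restrict_space)
qed

text \<open>The nested binds of \<open>logging_law\<close> are treated from the inside out. This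
  innermost kernel is jointly measurable in context and action, so that it can then be bound along
  \<open>\<pi>0\<close>.\<close>

lemma cost_law_measurable:
  "(\<lambda>(x, a). p x a \<bind> (\<lambda>c. return log_space (x, a, c)))
    \<in> context_space X \<Otimes>\<^sub>M action_space K \<rightarrow>\<^sub>M prob_algebra log_space"
proof -
  have "(\<lambda>z. (fst (fst z), snd (fst z), snd z))
      \<in> (context_space X \<Otimes>\<^sub>M action_space K) \<Otimes>\<^sub>M cost_space \<rightarrow>\<^sub>M log_space"
    by (intro measurable_Pair measurable_compose[OF measurable_fst] measurable_fst measurable_snd)
  from measurable_compose[OF this measurable_return_prob_space]
  have "(\<lambda>z. (case z of (x, a) \<Rightarrow> p x a) \<bind> (\<lambda>c. return log_space (fst z, snd z, c)))
      \<in> context_space X \<Otimes>\<^sub>M action_space K \<rightarrow>\<^sub>M prob_algebra log_space"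
    by (intro measurable_bind_prob_space2[OF cost_kernel_measurable]) (simp only: case_prod_beta')
  then show ?thesis
    by (simp only: case_prod_beta')
qed

lemma action_law_measurable:
  "(\<lambda>x. \<pi>0 x \<bind> (\<lambda>a. p x a \<bind> (\<lambda>c. return log_space (x, a, c))))
    \<in> context_space X \<rightarrow>\<^sub>M prob_algebra log_space"
  by (rule measurable_bind_prob_space2[OF policy_measurable(1) cost_law_measurable])

lemma sets_logging_law: "sets (logging_law X K \<nu> \<pi>0 p) = sets log_space"
  unfolding logging_law_def by (rule sets_bind'[OF \<nu> action_law_measurable])

lemma prob_space_logging_law: "prob_space (logging_law X K \<nu> \<pi>0 p)"
  unfolding logging_law_def by (rule prob_space_bind'[OF \<nu> action_law_measurable])

lemma space_logging_law: "space (logging_law X K \<nu> \<pi>0 p) = X \<times> {1..K} \<times> {-1..0}"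
  using sets_eq_imp_space_eq[OF sets_logging_law]
  by (simp add: space_pair_measure space_restrict_space)

text \<open>Integration against a bind is iterated integration, applied to the outer two binds and
  then to the last one, which ends in a point mass. The nonnegative form matters because
  integrability of the weighted cost is derived only later, from the value of its integral.\<close>

lemma nn_integral_logging_law:
  assumes f[measurable]: "f \<in> borel_measurable log_space"
  shows "(\<integral>\<^sup>+z. f z \<partial>logging_law X K \<nu> \<pi>0 p) = (\<integral>\<^sup>+x. \<integral>\<^sup>+a. \<integral>\<^sup>+c. f (x, a, c) \<partial>p x a \<partial>\<pi>0 x \<partial>\<nu>)"
proof -
  have "(\<integral>\<^sup>+z. f z \<partial>logging_law X K \<nu> \<pi>0 p)
      = (\<integral>\<^sup>+x. \<integral>\<^sup>+z. f z \<partial>(\<pi>0 x \<bind> (\<lambda>a. p x a \<bind> (\<lambda>c. return log_space (x, a, c)))) \<partial>\<nu>)"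
    unfolding logging_law_def
    by (rule nn_integral_bind[OF f]) (intro measurable_prob_algebraD,
        subst measurable_cong_sets[OF sets_\<nu> refl], rule action_law_measurable)
  also have "\<dots> = (\<integral>\<^sup>+x. \<integral>\<^sup>+a. \<integral>\<^sup>+c. f (x, a, c) \<partial>p x a \<partial>\<pi>0 x \<partial>\<nu>)"
  proof (rule nn_integral_cong)
    fix x assume "x \<in> space \<nu>"
    then have x: "x \<in> X" by (simp add: space_\<nu>)
    then have x'[measurable]: "x \<in> space (context_space X)" by (simp add: space_restrict_space)
    have [measurable_cong]: "sets (\<pi>0 x) = sets (action_space K)" by (rule policy_prob[OF x])
    have "(\<integral>\<^sup>+z. f z \<partial>(\<pi>0 x \<bind> (\<lambda>a. p x a \<bind> (\<lambda>c. return log_space (x, a, c)))))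
        = (\<integral>\<^sup>+a. \<integral>\<^sup>+z. f z \<partial>(p x a \<bind> (\<lambda>c. return log_space (x, a, c))) \<partial>\<pi>0 x)"
    proof (rule nn_integral_bind[OF f], rule measurable_prob_algebraD)
      show "(\<lambda>a. p x a \<bind> (\<lambda>c. return log_space (x, a, c))) \<in> \<pi>0 x \<rightarrow>\<^sub>M prob_algebra log_space"
        using measurable_compose[OF measurable_Pair1'[OF x'] cost_law_measurable]
        unfolding measurable_cong_sets[OF policy_prob(2)[OF x] refl] prod.case .
    qed
    also have "\<dots> = (\<integral>\<^sup>+a. \<integral>\<^sup>+c. f (x, a, c) \<partial>p x a \<partial>\<pi>0 x)"
    proof (rule nn_integral_cong)
      fix a assume "a \<in> space (\<pi>0 x)"
      then have a: "a \<in> {1..K}" by (simp add: policy_prob[OF x])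
      have [measurable_cong]: "sets (p x a) = sets cost_space" by (rule cost_kernel_prob[OF x a])
      have a'[measurable]: "a \<in> space (action_space K)" using a by simp
      have "(\<integral>\<^sup>+z. f z \<partial>(p x a \<bind> (\<lambda>c. return log_space (x, a, c))))
          = (\<integral>\<^sup>+c. \<integral>\<^sup>+z. f z \<partial>return log_space (x, a, c) \<partial>p x a)"
        by (rule nn_integral_bind[OF f]) measurable
      also have "\<dots> = (\<integral>\<^sup>+c. f (x, a, c) \<partial>p x a)"
        using x a cost_kernel_prob[OF x a]
        by (intro nn_integral_cong nn_integral_return f) (auto simp: space_pair_measure space_restrict_space)
      finally show "(\<integral>\<^sup>+z. f z \<partial>(p x a \<bind> (\<lambda>c. return log_space (x, a, c)))) = \<dots>" .
    qed
    finally show "(\<integral>\<^sup>+z. f z \<partial>(\<pi>0 x \<bind> (\<lambda>a. p x a \<bind> (\<lambda>c. return log_space (x, a, c))))) = \<dots>" .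
  qed
  finally show ?thesis .
qed

section \<open>Importance weights, mean costs and the risk\<close>

text \<open>For a fixed action the weight is a quotient of measurable functions of the context; the
  finitely many actions allow these to be glued into a jointly measurable function.\<close>

lemma importance_weight_measurable[measurable]:
  "(\<lambda>(x, a). importance_weight \<pi>0 \<pi> x a) \<in> borel_measurable (context_space X \<Otimes>\<^sub>M action_space K)"
proof -
  have [measurable]: "\<pi>0 \<in> context_space X \<rightarrow>\<^sub>M subprob_algebra (action_space K)"
    "\<pi> \<in> context_space X \<rightarrow>\<^sub>M subprob_algebra (action_space K)"
    by (rule measurable_prob_algebraD, rule policy_measurable)+
  have "(\<lambda>z. importance_weight \<pi>0 \<pi> (fst z) (snd z)) \<in> borel_measurable (context_space X \<Otimes>\<^sub>M action_space K)"
  proof (rule measurable_compose_countable'[where g = snd and I = "{1..K}"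
          and f = "\<lambda>a z. importance_weight \<pi>0 \<pi> (fst z) a"])
    fix a assume "a \<in> {1..K}"
    then have [measurable]: "{a} \<in> sets (action_space K)" by simp
    show "(\<lambda>z. importance_weight \<pi>0 \<pi> (fst z) a) \<in> borel_measurable (context_space X \<Otimes>\<^sub>M action_space K)"
      unfolding importance_weight_def by measurable
  qed auto
  then show ?thesis by (simp add: case_prod_beta)
qed

lemma weighted_cost_measurable:
  "(\<lambda>(x, a, c). - (importance_weight \<pi>0 \<pi> x a * c)) \<in> borel_measurable log_space"
proof -
  have [measurable]: "(\<lambda>c. c) \<in> borel_measurable cost_space"
    by (rule measurable_restrict_space1) simp
  show ?thesis by measurable
qed

lemma weighted_cost_nonneg:
  assumes "z \<in> space (logging_law X K \<nu> \<pi>0 p)"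
  shows "0 \<le> (case z of (x, a, c) \<Rightarrow> - (importance_weight \<pi>0 \<pi> x a * c))"
proof -
  have "0 \<le> importance_weight \<pi>0 \<pi> x a" for x a
    by (simp add: importance_weight_def)
  then show ?thesis
    using assms by (auto simp: space_logging_law intro!: mult_nonneg_nonpos)
qed

lemma mean_cost_measurable[measurable]:
  "(\<lambda>(x, a). mean_cost p x a) \<in> borel_measurable (context_space X \<Otimes>\<^sub>M action_space K)"
proof -
  have [measurable]: "(\<lambda>c. c) \<in> borel_measurable cost_space"
    by (rule measurable_restrict_space1) simp
  have "(\<lambda>z. \<integral>c. c \<partial>(case z of (x, a) \<Rightarrow> p x a)) \<in> borel_measurable (context_space X \<Otimes>\<^sub>M action_space K)"
    by (rule measurable_compose[OF measurable_prob_algebraD[OF cost_kernel_measurable]]) measurable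
  then show ?thesis by (simp add: case_prod_beta mean_cost_def)
qed

text \<open>Costs in [-1,0] are integrable under a probability measure, so a Bochner mean can be
  exchanged for the nonnegative integral of the negated cost. The bounds on the mean let the same
  passage be repeated over actions and over contexts.\<close>

lemma mean_cost_bounds:
  assumes "x \<in> X" "a \<in> {1..K}"
  shows "(\<integral>\<^sup>+c. ennreal (- c) \<partial>p x a) = ennreal (- mean_cost p x a)"
    and "mean_cost p x a \<in> {-1..0}"
proof -
  note pk = cost_kernel_prob[OF assms]
  interpret prob_space "p x a" by (rule pk)
  have [measurable]: "(\<lambda>c. c) \<in> borel_measurable (p x a)"
    unfolding measurable_cong_sets[OF pk(2) refl] by (rule measurable_restrict_space1) simp
  have i: "integrable (p x a) (\<lambda>c. c)"
    by (rule integrable_const_bound[of _ 1]) (auto simp: pk)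
  then have "(\<integral>\<^sup>+c. ennreal (- c) \<partial>p x a) = ennreal (\<integral>c. - c \<partial>p x a)"
    by (intro nn_integral_eq_integral) (auto simp: pk)
  then show "(\<integral>\<^sup>+c. ennreal (- c) \<partial>p x a) = ennreal (- mean_cost p x a)"
    by (simp add: mean_cost_def)
  show "mean_cost p x a \<in> {-1..0}"
    using integral_ge_const[OF i AE_I2, of "-1"] integral_le_const[OF i AE_I2, of 0]
    by (simp add: mean_cost_def pk)
qed

lemma policy_mean_cost:
  assumes "x \<in> X"
  shows "(\<integral>\<^sup>+a. ennreal (- mean_cost p x a) \<partial>\<pi> x) = ennreal (- (\<integral>a. mean_cost p x a \<partial>\<pi> x))"
    and "(\<integral>a. mean_cost p x a \<partial>\<pi> x) \<in> {-1..0}"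
proof -
  note pk = policy_prob(4-6)[OF assms]
  interpret prob_space "\<pi> x" by (rule pk)
  have [measurable]: "mean_cost p x \<in> borel_measurable (\<pi> x)"
    unfolding measurable_cong_sets[OF pk(2) refl] by simp
  have b: "mean_cost p x a \<in> {-1..0}" if "a \<in> {1..K}" for a
    using mean_cost_bounds(2)[OF assms that] .
  have i: "integrable (\<pi> x) (mean_cost p x)"
    by (rule integrable_const_bound[of _ 1]) (use b in \<open>force simp: pk intro!: AE_I2\<close>, measurable)
  then have "(\<integral>\<^sup>+a. ennreal (- mean_cost p x a) \<partial>\<pi> x) = ennreal (\<integral>a. - mean_cost p x a \<partial>\<pi> x)"
    using b by (intro nn_integral_eq_integral) (auto simp: pk)
  then show "(\<integral>\<^sup>+a. ennreal (- mean_cost p x a) \<partial>\<pi> x) = ennreal (- (\<integral>a. mean_cost p x a \<partial>\<pi> x))"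
    by simp
  show "(\<integral>a. mean_cost p x a \<partial>\<pi> x) \<in> {-1..0}"
    using integral_ge_const[OF i AE_I2, of "-1"] integral_le_const[OF i AE_I2, of 0] b
    by (simp add: pk)
qed

text \<open>The passage to nonnegative integrals at the level of contexts. The sign of the risk is
  recorded as well, because \<open>ennreal\<close> sends negative reals to 0 and
  \<open>ennreal (- risk \<nu> p \<pi>)\<close> determines the risk only together with it.\<close>

lemma nn_integral_policy_mean_cost:
  "(\<integral>\<^sup>+x. \<integral>\<^sup>+a. ennreal (- mean_cost p x a) \<partial>\<pi> x \<partial>\<nu>) = ennreal (- risk \<nu> p \<pi>)"
  and risk_nonpos: "risk \<nu> p \<pi> \<le> 0"
proof -
  interpret prob_space \<nu> by (rule prob_space_\<nu>)
  let ?r = "\<lambda>x. \<integral>a. mean_cost p x a \<partial>\<pi> x"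
  have b: "?r x \<in> {-1..0}" if "x \<in> X" for x
    using policy_mean_cost(2)[OF that] .
  have "(\<lambda>x. \<integral>\<^sup>+a. ennreal (- mean_cost p x a) \<partial>\<pi> x) \<in> borel_measurable (context_space X)"
  proof (rule nn_integral_measurable_subprob_algebra2[where N = "action_space K"])
    have "(\<lambda>z. ennreal (- (case z of (x, a) \<Rightarrow> mean_cost p x a)))
        \<in> borel_measurable (context_space X \<Otimes>\<^sub>M action_space K)"
      using mean_cost_measurable by measurable
    then show "(\<lambda>(x, a). ennreal (- mean_cost p x a)) \<in> borel_measurable (context_space X \<Otimes>\<^sub>M action_space K)"
      by (simp only: case_prod_beta')
    show "\<pi> \<in> context_space X \<rightarrow>\<^sub>M subprob_algebra (action_space K)"
      by (rule measurable_prob_algebraD, rule policy_measurable)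
  qed
  \<comment> \<open>Measurability of the inner Bochner integral is inherited from the nonnegative
    integral, with which it agrees on \<open>X\<close> up to sign and
    \<open>enn2real\<close>.\<close>
  then have "(\<lambda>x. - enn2real (\<integral>\<^sup>+a. ennreal (- mean_cost p x a) \<partial>\<pi> x)) \<in> borel_measurable \<nu>"
    unfolding measurable_cong_sets[OF sets_\<nu> refl] by measurable
  then have r: "?r \<in> borel_measurable \<nu>"
    by (rule measurable_cong[THEN iffD1, rotated]) (use b in \<open>simp add: space_\<nu> policy_mean_cost(1)\<close>)
  have i: "integrable \<nu> ?r"
    by (rule integrable_const_bound[of _ 1]) (use b r in \<open>force simp: space_\<nu> intro!: AE_I2\<close>)+
  have "(\<integral>\<^sup>+x. \<integral>\<^sup>+a. ennreal (- mean_cost p x a) \<partial>\<pi> x \<partial>\<nu>) = (\<integral>\<^sup>+x. ennreal (- ?r x) \<partial>\<nu>)"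
    by (intro nn_integral_cong policy_mean_cost(1)) (simp add: space_\<nu>)
  also have "\<dots> = ennreal (\<integral>x. - ?r x \<partial>\<nu>)"
    using i b by (intro nn_integral_eq_integral) (auto simp: space_\<nu>)
  finally show "(\<integral>\<^sup>+x. \<integral>\<^sup>+a. ennreal (- mean_cost p x a) \<partial>\<pi> x \<partial>\<nu>) = ennreal (- risk \<nu> p \<pi>)"
    by (simp add: risk_def)
  show "risk \<nu> p \<pi> \<le> 0"
    unfolding risk_def using integral_le_const[OF i AE_I2, of 0] b by (simp add: space_\<nu>)
qed

section \<open>Change of measure from the behavior policy to the target policy\<close>

text \<open>At a covered context the weight turns the mass of each action under
  \<open>\<pi>0\<close> into its mass under \<open>\<pi>\<close>, and pulls out of the cost integral
  as a constant. Coverage holds almost everywhere, hence so does the equality of the inner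
  integrals.\<close>

lemma nn_integral_weighted_cost:
  assumes cov: "covers \<nu> {1..K} \<pi>0 \<pi>"
  shows "(\<integral>\<^sup>+z. ennreal (case z of (x, a, c) \<Rightarrow> - (importance_weight \<pi>0 \<pi> x a * c)) \<partial>logging_law X K \<nu> \<pi>0 p)
    = ennreal (- risk \<nu> p \<pi>)"
proof -
  let ?w = "importance_weight \<pi>0 \<pi>"
  have "(\<integral>\<^sup>+z. ennreal (case z of (x, a, c) \<Rightarrow> - (?w x a * c)) \<partial>logging_law X K \<nu> \<pi>0 p)
      = (\<integral>\<^sup>+x. \<integral>\<^sup>+a. \<integral>\<^sup>+c. ennreal (- (?w x a * c)) \<partial>p x a \<partial>\<pi>0 x \<partial>\<nu>)"
    using nn_integral_logging_law[OF measurable_compose[OF weighted_cost_measurable measurable_ennreal]]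
    by simp
  also have "\<dots> = (\<integral>\<^sup>+x. \<integral>\<^sup>+a. ennreal (- mean_cost p x a) \<partial>\<pi> x \<partial>\<nu>)"
  proof (rule nn_integral_cong_AE)
    show "AE x in \<nu>. (\<integral>\<^sup>+a. \<integral>\<^sup>+c. ennreal (- (?w x a * c)) \<partial>p x a \<partial>\<pi>0 x)
        = (\<integral>\<^sup>+a. ennreal (- mean_cost p x a) \<partial>\<pi> x)"
      using cov[unfolded covers_def] AE_space
    proof eventually_elim
      fix x assume c: "\<forall>a\<in>{1..K}. measure (\<pi> x) {a} > 0 \<longrightarrow> measure (\<pi>0 x) {a} > 0"
        and "x \<in> space \<nu>"
      then have x: "x \<in> X" by (simp add: space_\<nu>)
      note P = policy_prob[OF x]
      interpret P0: prob_space "\<pi>0 x" by (rule P)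
      interpret P1: prob_space "\<pi> x" by (rule P)
      have "(\<integral>\<^sup>+a. \<integral>\<^sup>+c. ennreal (- (?w x a * c)) \<partial>p x a \<partial>\<pi>0 x)
          = (\<Sum>a\<in>{1..K}. (\<integral>\<^sup>+c. ennreal (- (?w x a * c)) \<partial>p x a) * emeasure (\<pi>0 x) {a})"
        by (rule nn_integral_sets_count_space_finite) (auto simp: P)
      also have "\<dots> = (\<Sum>a\<in>{1..K}. ennreal (- mean_cost p x a) * emeasure (\<pi> x) {a})"
      proof (rule sum.cong[OF refl])
        fix a assume a: "a \<in> {1..K}"
        note pk = cost_kernel_prob[OF x a]
        have [measurable]: "(\<lambda>c. c) \<in> borel_measurable (p x a)"
          unfolding measurable_cong_sets[OF pk(2) refl] by (rule measurable_restrict_space1) simp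
        have w: "0 \<le> ?w x a" by (simp add: importance_weight_def)
        have "(\<integral>\<^sup>+c. ennreal (- (?w x a * c)) \<partial>p x a) = (\<integral>\<^sup>+c. ennreal (?w x a) * ennreal (- c) \<partial>p x a)"
          using w by (intro nn_integral_cong) (simp add: pk ennreal_mult[symmetric])
        also have "\<dots> = ennreal (?w x a) * ennreal (- mean_cost p x a)"
          by (subst nn_integral_cmult) (auto simp: mean_cost_bounds(1)[OF x a])
        finally have 1: "(\<integral>\<^sup>+c. ennreal (- (?w x a * c)) \<partial>p x a)
            = ennreal (?w x a) * ennreal (- mean_cost p x a)" .
        \<comment> \<open>If \<open>\<pi>\<close> gives the action mass 0, both sides vanish, even
          when the quotient is 0/0 = 0. Otherwise coverage makes the denominator positive and it
          cancels.\<close>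
        have "?w x a * measure (\<pi>0 x) {a} = measure (\<pi> x) {a}"
          using c[rule_format, OF a] measure_nonneg[of "\<pi> x" "{a}"]
          by (cases "measure (\<pi> x) {a} = 0") (auto simp: importance_weight_def)
        then have "ennreal (?w x a) * emeasure (\<pi>0 x) {a} = emeasure (\<pi> x) {a}"
          using w by (simp add: P0.emeasure_eq_measure P1.emeasure_eq_measure ennreal_mult[symmetric])
        then show "(\<integral>\<^sup>+c. ennreal (- (?w x a * c)) \<partial>p x a) * emeasure (\<pi>0 x) {a}
            = ennreal (- mean_cost p x a) * emeasure (\<pi> x) {a}"
          unfolding 1 by (metis mult.assoc mult.commute)
      qed
      also have "\<dots> = (\<integral>\<^sup>+a. ennreal (- mean_cost p x a) \<partial>\<pi> x)"
        by (rule nn_integral_sets_count_space_finite[symmetric]) (auto simp: P)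
      finally show "(\<integral>\<^sup>+a. \<integral>\<^sup>+c. ennreal (- (?w x a * c)) \<partial>p x a \<partial>\<pi>0 x) = \<dots>" .
    qed
  qed
  also have "\<dots> = ennreal (- risk \<nu> p \<pi>)"
    by (rule nn_integral_policy_mean_cost)
  finally show ?thesis .
qed

text \<open>A nonnegative measurable function with finite nonnegative integral is integrable with
  that value, so integrability and the mean come together.\<close>

lemma has_bochner_integral_weighted_cost:
  assumes "covers \<nu> {1..K} \<pi>0 \<pi>"
  shows "has_bochner_integral (logging_law X K \<nu> \<pi>0 p)
    (\<lambda>(x, a, c). - (importance_weight \<pi>0 \<pi> x a * c)) (- risk \<nu> p \<pi>)"
proof (rule has_bochner_integral_nn_integral)
  show "(\<lambda>(x, a, c). - (importance_weight \<pi>0 \<pi> x a * c)) \<in> borel_measurable (logging_law X K \<nu> \<pi>0 p)"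
    using weighted_cost_measurable measurable_cong_sets[OF sets_logging_law refl] by blast
  show "AE z in logging_law X K \<nu> \<pi>0 p. 0 \<le> (case z of (x, a, c) \<Rightarrow> - (importance_weight \<pi>0 \<pi> x a * c))"
    by (intro AE_I2 weighted_cost_nonneg)
qed (use risk_nonpos nn_integral_weighted_cost[OF assms] in auto)

end

section \<open>The two deviation inequalities and the choice of the smoothing parameter\<close>

theorem proposition7:
  fixes X :: "(real ^ 'd::finite) set" and K n :: nat
    and \<nu> :: "(real ^ 'd) measure"
    and \<pi>0 \<pi> :: "real ^ 'd \<Rightarrow> nat measure"
    and p :: "real ^ 'd \<Rightarrow> nat \<Rightarrow> real measure"
    and L :: "((real ^ 'd) \<times> nat \<times> real) measure"
    and M :: "'w measure" and Z :: "nat \<Rightarrow> 'w \<Rightarrow> (real ^ 'd) \<times> nat \<times> real"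
    and \<delta> :: real
  assumes "compact X"
    and "\<nu> \<in> space (prob_algebra (context_space X))"
    and "\<pi>0 \<in> policies X K"
    and "\<pi> \<in> policies X K"
    and "p \<in> cost_kernels X K"
    and "covers \<nu> {1..K} \<pi>0 \<pi>"
    and "L = logging_law X K \<nu> \<pi>0 p"
    and "prob_space M"
    and "n \<ge> 1"
    and "iid_sample M n L Z"
    and "0 < \<delta>" and "\<delta> \<le> 1"
  shows "(\<forall>lam > 0.
            measure M {\<omega> \<in> space M.
              risk \<nu> p \<pi> - ls_estimator \<pi>0 n (\<lambda>i. Z i \<omega>) lam \<pi> \<le> ln (2 / \<delta>) / (lam * real n) \<and>
              ls_estimator \<pi>0 n (\<lambda>i. Z i \<omega>) lam \<pi> - risk \<nu> p \<pi>
                \<le> lam * ls_discrepancy L \<pi>0 lam \<pi> + ln (2 / \<delta>) / (lam * real n)}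
            \<ge> 1 - \<delta>) \<and>
         (let m2 = (\<integral>z. weighted_cost_sq \<pi>0 \<pi> z \<partial>L);
              lam_star = sqrt (ln (2 / \<delta>) / (real n * m2));
              sigma2 = 2 * m2 / real n
          in integrable L (weighted_cost_sq \<pi>0 \<pi>) \<and> 0 < m2 \<longrightarrow>
            measure M {\<omega> \<in> space M.
              \<bar>risk \<nu> p \<pi> - ls_estimator \<pi>0 n (\<lambda>i. Z i \<omega>) lam_star \<pi>\<bar>
                \<le> sqrt (2 * sigma2 * ln (2 / \<delta>))}
            \<ge> 1 - \<delta>)"
proof -
  let ?w = "importance_weight \<pi>0 \<pi>"
  define V where "V = (\<lambda>(x, a, c). - (?w x a * c))"
  interpret prob_space M by fact
  have "has_bochner_integral L V (- risk \<nu> p \<pi>)"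
    unfolding V_def \<open>L = _\<close> by (rule has_bochner_integral_weighted_cost) fact+
  then have int: "integrable L V" and m: "(\<integral>z. V z \<partial>L) = - risk \<nu> p \<pi>"
    by (auto simp: has_bochner_integral_iff)
  have "prob_space L"
    unfolding \<open>L = _\<close> by (rule prob_space_logging_law) fact+
  have nn: "0 \<le> V z" if "z \<in> space L" for z
    using weighted_cost_nonneg[OF assms(2-5), of z] that by (simp add: V_def \<open>L = _\<close>)
  have est: "(\<Sum>i = 1..n. ln (1 + lam * V (Z i \<omega>))) / (lam * real n)
      = - ls_estimator \<pi>0 n (\<lambda>i. Z i \<omega>) lam \<pi>" if "0 < lam" for lam \<omega>
  proof -
    have "(case z of (x, a, c) \<Rightarrow> (1 / lam) * ln (1 - lam * ?w x a * c)) = ln (1 + lam * V z) / lam" for z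
      by (cases z) (simp add: V_def mult.assoc)
    then show ?thesis
      by (simp add: ls_estimator_def flip: sum_divide_distrib)
  qed
  have disc: "(\<integral>z. (V z)\<^sup>2 / (1 + lam * V z) \<partial>L) = ls_discrepancy L \<pi>0 lam \<pi>" for lam
    unfolding ls_discrepancy_def
    by (intro Bochner_Integration.integral_cong) (auto simp: V_def mult.assoc)
  have sq: "weighted_cost_sq \<pi>0 \<pi> z = (V z)\<^sup>2" for z
    by (cases z) (simp add: weighted_cost_sq_def V_def power_mult_distrib)
  let ?G = "\<lambda>lam. {\<omega> \<in> space M.
              risk \<nu> p \<pi> - ls_estimator \<pi>0 n (\<lambda>i. Z i \<omega>) lam \<pi> \<le> ln (2 / \<delta>) / (lam * real n) \<and>
              ls_estimator \<pi>0 n (\<lambda>i. Z i \<omega>) lam \<pi> - risk \<nu> p \<pi>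
                \<le> lam * ls_discrepancy L \<pi>0 lam \<pi> + ln (2 / \<delta>) / (lam * real n)}"
  \<comment> \<open>Measurability of the estimator is kept alongside the bound: the two-sided event
    \<open>?H\<close> below must be measurable for monotonicity of the measure to apply.\<close>
  have G: "1 - \<delta> \<le> measure M (?G lam)"
    and meas: "(\<lambda>\<omega>. ls_estimator \<pi>0 n (\<lambda>i. Z i \<omega>) lam \<pi>) \<in> borel_measurable M"
    if lam: "0 < lam" for lam
  proof -
    \<comment> \<open>Here \<open>A\<close> and \<open>m\<close> are minus the estimator and minus
      the risk, so \<open>A \<omega> - m\<close> is risk minus estimator and the upper tail of the
      logarithms yields the first inequality.\<close>
    note * = iid_sample_log_smoothing[OF \<open>prob_space M\<close> \<open>iid_sample M n L Z\<close> \<open>n \<ge> 1\<close>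
        \<open>prob_space L\<close> int nn lam \<open>0 < \<delta>\<close>, unfolded est[OF lam] disc m]
    show "1 - \<delta> \<le> measure M (?G lam)"
      using *(2) by (simp add: algebra_simps)
    show "(\<lambda>\<omega>. ls_estimator \<pi>0 n (\<lambda>i. Z i \<omega>) lam \<pi>) \<in> borel_measurable M"
      using *(1) by simp
  qed
  define m2 where "m2 = (\<integral>z. weighted_cost_sq \<pi>0 \<pi> z \<partial>L)"
  define lam where "lam = sqrt (ln (2 / \<delta>) / (real n * m2))"
  define t where "t = sqrt (2 * (2 * m2 / real n) * ln (2 / \<delta>))"
  have "1 - \<delta> \<le> measure M {\<omega> \<in> space M. \<bar>risk \<nu> p \<pi> - ls_estimator \<pi>0 n (\<lambda>i. Z i \<omega>) lam \<pi>\<bar> \<le> t}"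
    (is "_ \<le> measure M ?H")
    if i2: "integrable L (weighted_cost_sq \<pi>0 \<pi>)" and m2: "0 < m2"
  proof -
    have n: "0 < real n" using \<open>n \<ge> 1\<close> by simp
    \<comment> \<open>From \<delta> \<le> 1 follows 2/\<delta> \<ge> 2 > 1; the strict sign is what
      makes \<open>lam\<close> positive.\<close>
    have l: "0 < ln (2 / \<delta>)" using \<open>0 < \<delta>\<close> \<open>\<delta> \<le> 1\<close> by simp
    have lam: "0 < lam" using n l m2 by (simp add: lam_def)
    have lam2: "lam * lam = ln (2 / \<delta>) / (real n * m2)"
      using n l m2 by (simp add: lam_def)
    \<comment> \<open>The choice of \<open>lam\<close> balances the two error terms: the deviation
      term equals lam m2, the bound for the bias term.\<close>
    have e: "ln (2 / \<delta>) / (lam * real n) = lam * m2"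
      using lam lam2 n m2 by (simp add: field_simps)
    \<comment> \<open>The radicand 4 m2 ln(2/\<delta>)/n is a perfect square, since lam^2 m2 =
      ln(2/\<delta>)/n.\<close>
    have "t = sqrt ((2 * (lam * m2))\<^sup>2)"
      unfolding t_def
      using lam2 n m2 by (intro arg_cong[where f=sqrt]) (simp add: field_simps power2_eq_square)
    then have t: "t = 2 * (lam * m2)"
      using lam m2 unfolding real_sqrt_abs by simp
    have V2: "integrable L (\<lambda>z. (V z)\<^sup>2)" "m2 = (\<integral>z. (V z)\<^sup>2 \<partial>L)"
      using i2 by (simp_all add: sq[abs_def] m2_def)
    have le: "(V z)\<^sup>2 / (1 + lam * V z) \<le> (V z)\<^sup>2" if "z \<in> space L" for z
    proof -
      have "1 \<le> 1 + lam * V z" using nn[OF that] lam by simp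
      then show ?thesis
        using divide_left_mono[of 1 "1 + lam * V z" "(V z)\<^sup>2"] by simp
    qed
    \<comment> \<open>The smoothing denominator is at least 1, so the integrand lies below V^2,
      whose integrability is the finite second moment assumed here.\<close>
    have "ls_discrepancy L \<pi>0 lam \<pi> \<le> m2"
      unfolding disc[symmetric] V2(2)
      using le nn lam V2(1) by (intro integral_mono_AE' AE_I2) auto
    then have S: "lam * ls_discrepancy L \<pi>0 lam \<pi> \<le> lam * m2"
      using lam by simp
    have nn2: "0 \<le> lam * m2" using lam m2 by simp
    have H: "?H \<in> sets M"
      using meas[OF lam] by measurable
    \<comment> \<open>One side is at most lam m2, which \<open>nn2\<close> places below
      \<open>t\<close>; the other is at most lam m2 + lam m2 = \<open>t\<close>.\<close>
    have "?G lam \<subseteq> ?H"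
      unfolding e t using S nn2 by auto
    then show ?thesis
      using G[OF lam] finite_measure_mono[OF _ H] by (meson order.trans)
  qed
  then show ?thesis
    using G unfolding Let_def m2_def[symmetric] lam_def[symmetric] t_def[symmetric] by blast
qed

end
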